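(* Let $k$ and $n$ be non-negative integers. Let $p_1,p_2,\dots,p_{k+1}$ be primes such that $p_i\equiv 2\pmod 3$ for each $1\le i\le k+1$. Then for any integer $j\not\equiv 0\pmod{p_{k+1}}$, $$B_5\left(p_1^2p_2^2\cdots p_k^2p_{k+1}^2\,n+\frac{p_1^2p_2^2\cdots p_k^2\,p_{k+1}(3j+p_{k+1})-1}{3}\right)\equiv 0\pmod 5.$$
   Context: A partition is called $5$-regular if none of its parts is divisible by $5$. $B_5(n)$ denotes the number of ordered pairs $(\lambda,\mu)$ of $5$-regular partitions such that the sum of all parts of $\lambda$ and $\mu$ equals $n$ (so $B_5(0)=1$); equivalently $\sum_{n\ge 0}B_5(n)q^n=\prod_{k\ge1}\frac{(1-q^{5k})^2}{(1-q^k)^2}$. By convention $B_5(n)=0$ for negative integers $n$. The primes $p_i$ are not assumed distinct; for $k=0$ the product $p_1^2\cdots p_k^2$ is $1$. *)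

theory Defs
  imports "HOL-Library.Multiset" "HOL-Number_Theory.Number_Theory"
begin

text \<open>A partition is the finite multiset of its parts, which are positive integers.\<close>

definition is_partition :: "nat multiset \<Rightarrow> bool" where
  "is_partition \<alpha> \<longleftrightarrow> (\<forall>x\<in>#\<alpha>. 0 < x)"

definition regular_partition :: "nat \<Rightarrow> nat multiset \<Rightarrow> bool" where
  "regular_partition l \<alpha> \<longleftrightarrow> is_partition \<alpha> \<and> (\<forall>x\<in>#\<alpha>. \<not> l dvd x)"

text \<open>The argument is an integer, so that the convention \<open>B5 m = 0\<close> for negative \<open>m\<close>
  is automatic: no pair of partitions has a negative total.\<close>

definition B5 :: "int \<Rightarrow> nat" where
  "B5 m = card {(\<alpha>, \<beta>). regular_partition 5 \<alpha> \<and> regular_partition 5 \<beta> \<and>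
                        int (sum_mset \<alpha> + sum_mset \<beta>) = m}"

lemma B5_neg: "m < 0 \<Longrightarrow> B5 m = 0"
proof -
  assume "m < 0"
  then have "{(\<alpha>, \<beta>). regular_partition 5 \<alpha> \<and> regular_partition 5 \<beta> \<and>
               int (sum_mset \<alpha> + sum_mset \<beta>) = m} = {}"
    using of_nat_less_0_iff by blast
  then show ?thesis unfolding B5_def by (simp only: card.empty)
qed

lemma is_partition_size_le: "is_partition \<alpha> \<Longrightarrow> size \<alpha> \<le> sum_mset \<alpha>"
  unfolding is_partition_def by (induction \<alpha>) (auto simp: Suc_le_eq add_strict_increasing2)

text \<open>\<open>card\<close> is \<open>0\<close> on infinite sets; here it is always applied to a finite set.\<close>

lemma finite_partitions_le: "finite {\<alpha>. is_partition \<alpha> \<and> sum_mset \<alpha> \<le> N}"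
proof (rule finite_subset)
  show "{\<alpha>. is_partition \<alpha> \<and> sum_mset \<alpha> \<le> N} \<subseteq>
        mset ` {xs. set xs \<subseteq> {..N} \<and> length xs \<le> N}"
  proof
    fix \<alpha> assume "\<alpha> \<in> {\<alpha>. is_partition \<alpha> \<and> sum_mset \<alpha> \<le> N}"
    then have p: "is_partition \<alpha>" and s: "sum_mset \<alpha> \<le> N" by auto
    obtain xs where xs: "mset xs = \<alpha>" using ex_mset by blast
    have "length xs \<le> N" using is_partition_size_le[OF p] s xs by auto
    moreover have "set xs \<subseteq> {..N}"
      using s xs member_le_sum_list[of _ xs] by (fastforce simp: sum_mset_sum_list)
    ultimately show "\<alpha> \<in> mset ` {xs. set xs \<subseteq> {..N} \<and> length xs \<le> N}"
      using xs by blast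
  qed
  show "finite (mset ` {xs. set xs \<subseteq> {..N} \<and> length xs \<le> N})"
    by (intro finite_imageI finite_lists_length_le) simp
qed

lemma finite_B5_set:
  "finite {(\<alpha>, \<beta>). regular_partition 5 \<alpha> \<and> regular_partition 5 \<beta> \<and>
                   int (sum_mset \<alpha> + sum_mset \<beta>) = m}"
proof -
  have "sum_mset \<alpha> \<le> nat m \<and> sum_mset \<beta> \<le> nat m"
    if "int (sum_mset \<alpha> + sum_mset \<beta>) = m" for \<alpha> \<beta> :: "nat multiset"
    using that by linarith
  then show ?thesis
    by (intro finite_subset[OF _ finite_cartesian_product
          [OF finite_partitions_le[of "nat m"] finite_partitions_le[of "nat m"]]])
       (clarsimp simp only: regular_partition_def mem_Sigma_iff mem_Collect_eq subset_iff simp_thms)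
qed

text \<open>Hence the \<open>div 3\<close> in the argument of \<open>B5\<close> in the theorem is an exact division.\<close>

lemma three_dvd_B5_argument:
  fixes p :: "nat \<Rightarrow> nat" and j :: int
  assumes "\<And>i. i \<in> {1..k+1} \<Longrightarrow> [p i = 2] (mod 3)"
  shows "3 dvd (\<Prod>i=1..k. (int (p i))\<^sup>2) * int (p (k+1)) * (3 * j + int (p (k+1))) - 1"
proof -
  have sq: "[(int (p i))\<^sup>2 = 1] (mod 3)" if "i \<in> {1..k+1}" for i
  proof -
    have "[int (p i) = 2] (mod 3)"
      using assms[OF that] cong_int_iff[of "p i" 2 3] by simp
    then have "[(int (p i))\<^sup>2 = 2\<^sup>2] (mod 3)" by (rule cong_pow)
    then show ?thesis by (simp add: cong_def)
  qed
  have "[(\<Prod>i=1..k. (int (p i))\<^sup>2) = (\<Prod>i=1..k. 1)] (mod 3)"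
    by (rule cong_prod) (use sq in auto)
  then have "[(\<Prod>i=1..k. (int (p i))\<^sup>2) * (int (p (k+1)))\<^sup>2 = 1 * 1] (mod 3)"
    using sq[of "k+1"] by (intro cong_mult) auto
  then have "3 dvd (\<Prod>i=1..k. (int (p i))\<^sup>2) * (int (p (k+1)))\<^sup>2 - 1"
    by (simp add: cong_iff_dvd_diff)
  then have "3 dvd ((\<Prod>i=1..k. (int (p i))\<^sup>2) * (int (p (k+1)))\<^sup>2 - 1)
                   + 3 * ((\<Prod>i=1..k. (int (p i))\<^sup>2) * int (p (k+1)) * j)"
    by (intro dvd_add) auto
  then show ?thesis by (simp add: algebra_simps power2_eq_square)
qed

end

theory Submission
  imports Defs "HOL-Computational_Algebra.Formal_Power_Series" "HOL-Computational_Algebra.Polynomial"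
begin

text \<open>
  Write \<open>f = \<Prod>(1 - q^k)\<close>. Modulo \<open>5\<close> the generating function of \<open>B5\<close> is \<open>f^8\<close>, because
  \<open>(1 - q^k)^5\<close> is congruent to \<open>1 - q^(5k)\<close>. The coefficient of \<open>q^N\<close> in \<open>f^8\<close> vanishes unless
  \<open>3N + 1\<close> is a value of \<open>u^2 - uv + v^2\<close>, and a prime congruent to \<open>2\<close> modulo \<open>3\<close> divides such a
  value to an even power; in the theorem \<open>p_(k+1)\<close> divides \<open>3N + 1\<close> to an odd power.

  The vanishing is read off Macdonald's identity for the root system \<open>A_2\<close>. With
  \<open>T(j) = j(j-1)/2\<close>, Jacobi's \<open>f^3 = - \<Sum>(-1)^j j q^T(j)\<close> and \<open>\<Sum>(-1)^j q^T(j) = 0\<close> give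
  \<open>2 f^9 = \<Sum>(-1)^(l+m+n) (l-n)^2 (m-n) q^(T(l)+T(m)+T(n))\<close>, since every other monomial of
  \<open>(l-n)^2 (m-n)\<close> misses one variable. Now sum along the lines on which \<open>u = l-n\<close> and
  \<open>v = m-n\<close> are constant. If \<open>3\<close> divides \<open>u + v\<close> the terms cancel in pairs; otherwise the line contributes
  a multiple of \<open>f\<close>, by the pentagonal number theorem, at the exponent \<open>(u^2-uv+v^2-1)/3\<close>.
  Cancelling \<open>f\<close> leaves \<open>2 f^8\<close> as a sum over pairs \<open>(u, v)\<close>.
\<close>

unbundle fps_syntax

section \<open>Congruence of power series modulo an integer and a power of the variable\<close>

text \<open>For \<open>d = 0\<close> this is equality of the first \<open>N\<close> coefficients.\<close>

definition fps_cong :: "int \<Rightarrow> nat \<Rightarrow> int fps \<Rightarrow> int fps \<Rightarrow> bool" where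
  "fps_cong d N f g \<longleftrightarrow> (\<forall>i<N. [f $ i = g $ i] (mod d))"

lemma fps_cong_refl [simp]: "fps_cong d N f f"
  by (simp add: fps_cong_def)

lemma fps_cong_sym: "fps_cong d N f g \<Longrightarrow> fps_cong d N g f"
  by (simp add: fps_cong_def cong_sym_eq)

lemma fps_cong_trans [trans]:
  "fps_cong d N f g \<Longrightarrow> fps_cong d N g h \<Longrightarrow> fps_cong d N f h"
  unfolding fps_cong_def by (meson cong_trans)

lemma fps_cong_mono: "fps_cong d N f g \<Longrightarrow> M \<le> N \<Longrightarrow> fps_cong d M f g"
  by (simp add: fps_cong_def)

lemma fps_cong_zero_imp: "fps_cong 0 N f g \<Longrightarrow> fps_cong d N f g"
  by (simp add: fps_cong_def cong_def)

lemma fps_cong_mult: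
  assumes "fps_cong d N f g" "fps_cong d N f' g'"
  shows "fps_cong d N (f * f') (g * g')"
  unfolding fps_cong_def fps_mult_nth
proof (intro allI impI cong_sum cong_mult)
  fix i j assume "i < N" "j \<in> {0..i}"
  then show "[f $ j = g $ j] (mod d)" "[f' $ (i - j) = g' $ (i - j)] (mod d)"
    using assms by (auto simp: fps_cong_def)
qed

lemma fps_cong_pow: "fps_cong d N f g \<Longrightarrow> fps_cong d N (f ^ k) (g ^ k)"
  by (induction k) (auto intro: fps_cong_mult)

lemma fps_cong_sum:
  "(\<And>x. x \<in> S \<Longrightarrow> fps_cong d N (f x) (g x)) \<Longrightarrow> fps_cong d N (sum f S) (sum g S)"
  by (auto simp: fps_cong_def fps_sum_nth intro!: cong_sum)

lemma fps_cong_prod: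
  "(\<And>x. x \<in> S \<Longrightarrow> fps_cong d N (f x) (g x)) \<Longrightarrow> fps_cong d N (prod f S) (prod g S)"
  by (induction S rule: infinite_finite_induct) (auto intro: fps_cong_mult)

lemma fps_cong_X_power_mult:
  assumes "fps_cong d N f g"
  shows "fps_cong d (k + N) (fps_X ^ k * f) (fps_X ^ k * g)"
  using assms by (auto simp: fps_cong_def fps_X_power_mult_nth)

lemma fps_cong_one_minus_X_power: "N \<le> k \<Longrightarrow> fps_cong d N (1 - fps_X ^ k) 1"
  by (auto simp: fps_cong_def fps_X_power_nth)

lemma fps_eqI_cong:
  assumes "\<And>N. fps_cong 0 (Suc N) f g"
  shows "f = g"
proof (rule fps_ext)
  fix N show "f $ N = g $ N"
    using assms[of N] by (auto simp: fps_cong_def cong_def)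
qed

lemma fps_cong_uminus: "fps_cong d N f g \<Longrightarrow> fps_cong d N (- f) (- g)"
  by (simp add: fps_cong_def cong_minus_minus_iff)

section \<open>Euler's product and the generating function of \<open>B5\<close>\<close>

definition qpoch :: "nat \<Rightarrow> int fps" where
  "qpoch n = (\<Prod>k=1..n. 1 - fps_X ^ k)"

lemma qpoch_0 [simp]: "qpoch 0 = 1"
  by (simp add: qpoch_def)

lemma qpoch_Suc [simp]: "qpoch (Suc n) = qpoch n * (1 - fps_X ^ Suc n)"
  by (simp add: qpoch_def)

lemma qpoch_cong:
  assumes "m \<le> n"
  shows "fps_cong 0 (Suc m) (qpoch n) (qpoch m)"
  using assms
proof (induction n rule: dec_induct)
  case (step n)
  have "fps_cong 0 (Suc m) (qpoch n * (1 - fps_X ^ Suc n)) (qpoch m * 1)"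
    using step by (intro fps_cong_mult fps_cong_one_minus_X_power) auto
  then show ?case by simp
qed simp

text \<open>The infinite product without a limit: factors beyond \<open>1 - fps_X ^ n\<close> no
  longer affect the coefficient of \<open>fps_X ^ n\<close>, so the diagonal of the partial products
  holds every coefficient.\<close>

definition euler :: "int fps" where
  "euler = Abs_fps (\<lambda>n. qpoch n $ n)"

lemma euler_cong:
  assumes "N \<le> Suc n"
  shows "fps_cong d N euler (qpoch n)"
  unfolding fps_cong_def
proof (intro allI impI)
  fix i assume "i < N"
  then have "qpoch n $ i = qpoch i $ i"
    using qpoch_cong[of i n] assms by (auto simp: fps_cong_def cong_def)
  then show "[euler $ i = qpoch n $ i] (mod d)"
    by (simp add: euler_def)
qed

lemma euler_nz: "euler \<noteq> 0"
proof -
  have "euler $ 0 = 1" by (simp add: euler_def)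
  then show ?thesis by force
qed

text \<open>Induction on \<open>S\<close>. A multiset over \<open>insert s S\<close> either avoids
  \<open>s\<close> or is one copy of \<open>s\<close> added to another such multiset, of sum smaller
  by \<open>s\<close>; so adjoining \<open>s\<close> divides the series by
  \<open>1 - fps_X ^ s\<close>.\<close>

lemma partition_gf:
  assumes "finite S" "0 \<notin> S"
  shows "Abs_fps (\<lambda>n. int (card {\<alpha>. set_mset \<alpha> \<subseteq> S \<and> sum_mset \<alpha> = n})) * (\<Prod>i\<in>S. 1 - fps_X ^ i) = 1"
  using assms
proof (induction S rule: finite_induct)
  case empty
  have "{\<alpha>. \<alpha> = {#} \<and> \<Sum>\<^sub># \<alpha> = n} = (if n = 0 then {{#}} else {})" for n :: nat
    by auto
  then show ?case by (auto simp: fps_eq_iff)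
next
  case (insert s S)
  let ?P = "\<lambda>S n. {\<alpha>. set_mset \<alpha> \<subseteq> S \<and> sum_mset \<alpha> = (n::nat)}"
  have fin: "finite (?P S n)" if "0 \<notin> S" for S n
    by (rule finite_subset[OF _ finite_partitions_le[of n]])
       (use that in \<open>auto simp: is_partition_def intro!: gr0I\<close>)
  have rec: "card (?P (insert s S) n) = card (?P S n) + (if s \<le> n then card (?P (insert s S) (n - s)) else 0)" for n
  proof -
    have eq: "?P (insert s S) n = ?P S n \<union> (if s \<le> n then (add_mset s) ` ?P (insert s S) (n - s) else {})"
    proof (intro equalityI subsetI)
      fix \<alpha> assume a: "\<alpha> \<in> ?P (insert s S) n"
      show "\<alpha> \<in> ?P S n \<union> (if s \<le> n then (add_mset s) ` ?P (insert s S) (n - s) else {})"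
      proof (cases "s \<in># \<alpha>")
        case True
        then obtain \<beta> where "\<alpha> = add_mset s \<beta>" by (metis insert_DiffM)
        with a show ?thesis by auto
      next
        case False
        with a show ?thesis by auto
      qed
    qed (auto split: if_splits)
    have "s \<notin># \<alpha>" if "\<alpha> \<in> ?P S n" for \<alpha>
      using that insert.hyps by blast
    moreover have "s \<in># \<alpha>" if "\<alpha> \<in> add_mset s ` B" for \<alpha> B
      using that by auto
    ultimately have "?P S n \<inter> (add_mset s) ` ?P (insert s S) (n - s) = {}"
      by blast
    then have "card (?P S n \<union> (add_mset s) ` ?P (insert s S) (n - s)) = card (?P S n) + card (?P (insert s S) (n - s))"
      using fin[of S n] fin[of "insert s S" "n - s"] insert.prems
      by (subst card_Un_disjoint) (simp_all add: card_image inj_on_def)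
    then show ?thesis
      unfolding eq by (simp split: if_split)
  qed
  define R where "R = (\<lambda>S. Abs_fps (\<lambda>n. int (card (?P S n))))"
  have "R (insert s S) * (1 - fps_X ^ s) = R S"
  proof (rule fps_ext)
    fix n
    have "R (insert s S) $ n = R S $ n + (if s \<le> n then R (insert s S) $ (n - s) else 0)"
      using rec[of n] by (simp add: R_def del: insert_subset)
    then show "(R (insert s S) * (1 - fps_X ^ s)) $ n = R S $ n"
      by (auto simp: right_diff_distrib fps_X_power_mult_right_nth)
  qed
  moreover have "R S * (\<Prod>i\<in>S. 1 - fps_X ^ i) = 1"
    unfolding R_def by (rule insert.IH) (use insert.prems in auto)
  ultimately have "R (insert s S) * (\<Prod>i\<in>insert s S. 1 - fps_X ^ i) = 1"
    unfolding prod.insert[OF insert.hyps] mult.assoc[symmetric] by (simp only:)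
  then show ?case
    unfolding R_def .
qed

lemma one_minus_X_power_5_cong: "fps_cong 5 N ((1 - fps_X ^ k) ^ 5) (1 - fps_X ^ (5 * k))"
proof -
  define Y where "Y = (fps_X :: int fps) ^ k"
  have "(1 - Y) ^ 5 = (1 - Y ^ 5) + 5 * (- Y + 2 * Y ^ 2 - 2 * Y ^ 3 + Y ^ 4)"
    by (simp add: eval_nat_numeral algebra_simps)
  then have "((1 - Y) ^ 5) $ i = (1 - Y ^ 5) $ i + 5 * (- Y + 2 * Y ^ 2 - 2 * Y ^ 3 + Y ^ 4) $ i" for i
    by (simp add: numeral_fps_const)
  then show ?thesis
    unfolding Y_def power_mult[symmetric] mult.commute[of 5 k]
    by (auto simp: fps_cong_def cong_iff_dvd_diff)
qed

text \<open>Parts up to \<open>m\<close> suffice for this coefficient. Cancelling the factors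
  \<open>C\<close> at multiples of 5 gives \<open>R S = R {1..m} * C\<close>. Modulo 5 and up to
  degree \<open>m\<close>, \<open>C\<close> is \<open>qpoch m ^ 5\<close>; as
  \<open>R {1..m}\<close> is inverse to \<open>qpoch m\<close>, the square of \<open>R S\<close>
  becomes \<open>qpoch m ^ 8\<close>.\<close>

lemma B5_cong_euler: "[int (B5 (int m)) = (euler ^ 8) $ m] (mod 5)"
proof -
  let ?P = "\<lambda>S n. {\<alpha>. set_mset \<alpha> \<subseteq> S \<and> sum_mset \<alpha> = (n::nat)}"
  define S where "S = {i\<in>{1..m}. \<not> 5 dvd i}"
  define S' where "S' = {i\<in>{1..m}. 5 dvd i}"
  define R where "R = (\<lambda>S. Abs_fps (\<lambda>n. int (card (?P S n))))"
  define C where "C = (\<Prod>i\<in>S'. 1 - (fps_X :: int fps) ^ i)"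
  define A where "A = (\<Prod>i\<in>S. 1 - (fps_X :: int fps) ^ i)"
  define D where "D = (\<Prod>i\<in>{1..m}. 1 - (fps_X :: int fps) ^ (5 * i))"
  have SU: "{1..m} = S \<union> S'" "S \<inter> S' = {}" "finite S" "finite S'" "0 \<notin> S"
    by (auto simp: S_def S'_def)
  have Q: "qpoch m = A * C"
    unfolding qpoch_def A_def C_def by (subst SU(1), subst prod.union_disjoint) (use SU in auto)
  have RA: "R S * A = 1"
    unfolding R_def A_def by (rule partition_gf) (use SU in auto)
  have RQ: "R {1..m} * qpoch m = 1"
    unfolding R_def qpoch_def by (rule partition_gf) auto
  have RC: "R S = R {1..m} * C"
  proof -
    have "R S = R S * (R {1..m} * qpoch m)" using RQ by (simp only: mult_1_right)
    also have "\<dots> = R S * A * (R {1..m} * C)" by (simp only: Q mult_ac)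
    finally show ?thesis by (simp add: RA)
  qed
  define P where "P = ?P S"
  have P_iff: "\<alpha> \<in> P i \<longleftrightarrow> set_mset \<alpha> \<subseteq> S \<and> sum_mset \<alpha> = i" for \<alpha> i
    by (simp add: P_def)
  have "set_mset \<gamma> \<subseteq> S" if "regular_partition 5 \<gamma>" "sum_mset \<gamma> \<le> m" for \<gamma>
  proof
    fix x assume x: "x \<in># \<gamma>"
    then obtain \<gamma>' where "\<gamma> = add_mset x \<gamma>'" by (meson mset_add)
    then have "x \<le> sum_mset \<gamma>" by simp
    with x that show "x \<in> S"
      by (auto simp: S_def regular_partition_def is_partition_def Suc_le_eq)
  qed
  moreover have "regular_partition 5 \<gamma>" if "set_mset \<gamma> \<subseteq> S" for \<gamma>
    using that by (auto simp: S_def regular_partition_def is_partition_def subset_iff Suc_le_eq)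
  ultimately have reg: "regular_partition 5 \<gamma> \<longleftrightarrow> \<gamma> \<in> P (sum_mset \<gamma>)" if "sum_mset \<gamma> \<le> m" for \<gamma>
    using that by (auto simp only: P_iff)
  have "{(\<alpha>, \<beta>). regular_partition 5 \<alpha> \<and> regular_partition 5 \<beta> \<and> int (sum_mset \<alpha> + sum_mset \<beta>) = int m}
      = (\<Union>i\<le>m. P i \<times> P (m - i))" (is "?L = ?R")
  proof (intro equalityI subsetI)
    fix z assume "z \<in> ?L"
    then obtain \<alpha> \<beta> where z: "z = (\<alpha>, \<beta>)" "regular_partition 5 \<alpha>" "regular_partition 5 \<beta>"
      and s: "sum_mset \<alpha> + sum_mset \<beta> = m" by (auto simp del: of_nat_add)
    have "sum_mset \<alpha> \<le> m" "sum_mset \<beta> = m - sum_mset \<alpha>" using s by auto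
    moreover have "\<alpha> \<in> P (sum_mset \<alpha>)" "\<beta> \<in> P (sum_mset \<beta>)"
      using z s by (auto simp flip: reg)
    ultimately show "z \<in> ?R"
      using z(1) by auto
  next
    fix z assume "z \<in> ?R"
    then obtain \<alpha> \<beta> i where z: "z = (\<alpha>, \<beta>)" "\<alpha> \<in> P i" "\<beta> \<in> P (m - i)" "i \<le> m"
      by auto
    moreover from this have "sum_mset \<alpha> = i" "sum_mset \<beta> = m - i"
      by (simp_all add: P_iff)
    ultimately show "z \<in> ?L"
      using reg[of \<alpha>] reg[of \<beta>] by (simp del: of_nat_add)
  qed
  then have "B5 (int m) = card (\<Union>i\<le>m. P i \<times> P (m - i))"
    unfolding B5_def by (rule arg_cong)
  also have "\<dots> = (\<Sum>i\<le>m. card (P i \<times> P (m - i)))"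
  proof (rule card_UN_disjoint)
    have "finite (P n)" for n
      by (rule finite_subset[OF _ finite_partitions_le[of n]]) (auto simp: is_partition_def S_def P_iff subset_iff)
    then show "\<forall>i\<in>{..m}. finite (P i \<times> P (m - i))" by blast
    have "P i \<inter> P j = {}" if "i \<noteq> j" for i j
      using that by (auto simp: P_iff)
    then show "\<forall>i\<in>{..m}. \<forall>j\<in>{..m}. i \<noteq> j \<longrightarrow> P i \<times> P (m - i) \<inter> P j \<times> P (m - j) = {}"
      by (simp add: Times_Int_Times)
  qed simp
  finally have "int (B5 (int m)) = (R S * R S) $ m"
    by (simp add: R_def fps_mult_nth card_cartesian_product atLeast0AtMost P_def)
  also have "R S * R S = R {1..m} ^ 2 * C ^ 2"
    by (simp only: RC power2_eq_square mult_ac)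
  finally have B: "int (B5 (int m)) = (R {1..m} ^ 2 * C ^ 2) $ m" .
  \<comment> \<open>\<open>D\<close> runs over the multiples of 5 up to \<open>5 * m\<close>,
    \<open>C\<close> only over those up to \<open>m\<close>; the surplus factors are 1 up to degree
    \<open>m\<close>.\<close>
  have "fps_cong 5 (Suc m) C D"
  proof (rule fps_cong_zero_imp)
    have D: "D = (\<Prod>i\<in>(\<lambda>i. 5 * i) ` {1..m}. 1 - fps_X ^ i)"
      unfolding D_def by (subst prod.reindex) (auto simp: inj_on_def)
    have "S' \<subseteq> (\<lambda>i. 5 * i) ` {1..m}"
      by (auto simp: S'_def elim!: dvdE)
    then have "D = C * (\<Prod>i\<in>(\<lambda>i. 5 * i) ` {1..m} - S'. 1 - fps_X ^ i)"
      unfolding C_def D by (metis finite_atLeastAtMost finite_imageI mult.commute prod.subset_diff)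
    moreover have "fps_cong 0 (Suc m) (C * (\<Prod>i\<in>(\<lambda>i. 5 * i) ` {1..m} - S'. 1 - fps_X ^ i)) (C * (\<Prod>i\<in>(\<lambda>i. 5 * i) ` {1..m} - S'. 1))"
      by (intro fps_cong_mult fps_cong_prod fps_cong_one_minus_X_power fps_cong_refl) (auto simp: S'_def)
    ultimately show "fps_cong 0 (Suc m) C D"
      by (simp add: fps_cong_sym)
  qed
  also have "fps_cong 5 (Suc m) D (qpoch m ^ 5)"
    unfolding D_def qpoch_def prod_power_distrib
    by (intro fps_cong_prod fps_cong_sym[OF one_minus_X_power_5_cong])
  finally have "fps_cong 5 (Suc m) (R {1..m} ^ 2 * C ^ 2) (R {1..m} ^ 2 * (qpoch m ^ 5) ^ 2)"
    by (intro fps_cong_mult fps_cong_pow fps_cong_refl)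
  also have "R {1..m} ^ 2 * (qpoch m ^ 5) ^ 2 = (R {1..m} * qpoch m) ^ 2 * qpoch m ^ 8"
    by (simp add: power_mult_distrib power_mult[symmetric] power_add[symmetric])
  also have "fps_cong 5 (Suc m) \<dots> (euler ^ 8)"
    unfolding RQ using fps_cong_sym[OF fps_cong_pow[OF euler_cong[of "Suc m" m 5], of 8]] by simp
  finally show ?thesis
    unfolding B fps_cong_def by auto
qed

section \<open>Sums over weighted sets\<close>

text \<open>Meaningful only if every fibre of the weight \<open>w\<close> is finite: an infinite fibre contributes \<open>0\<close>.\<close>

definition wsum :: "'a set \<Rightarrow> ('a \<Rightarrow> int) \<Rightarrow> ('a \<Rightarrow> nat) \<Rightarrow> int fps" where
  "wsum A c w = Abs_fps (\<lambda>N. \<Sum>x\<in>{x\<in>A. w x = N}. c x)"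

lemma wsum_cong_sum:
  assumes "finite S" "S \<subseteq> A" "\<And>x. x \<in> A \<Longrightarrow> w x < M \<Longrightarrow> x \<in> S"
  shows "fps_cong d M (wsum A c w) (\<Sum>x\<in>S. fps_const (c x) * fps_X ^ w x)"
  unfolding fps_cong_def
proof (intro allI impI)
  fix N assume N: "N < M"
  have "(\<Sum>x\<in>S. fps_const (c x) * fps_X ^ w x) $ N = (\<Sum>x\<in>S. if w x = N then c x else 0)"
    by (auto simp: fps_sum_nth fps_X_power_nth intro!: sum.cong)
  also have "\<dots> = (\<Sum>x\<in>{x\<in>S. w x = N}. c x)"
    using assms by (simp add: sum.inter_filter)
  also have "{x\<in>S. w x = N} = {x\<in>A. w x = N}"
    using assms N by auto
  finally show "[wsum A c w $ N = (\<Sum>x\<in>S. fps_const (c x) * fps_X ^ w x) $ N] (mod d)"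
    by (simp add: wsum_def)
qed

lemma wsum_nth: "wsum A c w $ N = (\<Sum>x\<in>{x\<in>A. w x = N}. c x)"
  by (simp add: wsum_def)

lemma finite_fibres_Times:
  assumes "\<And>N. finite {x\<in>A. w x = (N::nat)}" "\<And>N. finite {y\<in>B. v y = (N::nat)}"
  shows "finite {z\<in>A \<times> B. (case z of (x, y) \<Rightarrow> w x + v y) = N}"
proof (rule finite_subset)
  show "{z\<in>A \<times> B. (case z of (x, y) \<Rightarrow> w x + v y) = N}
    \<subseteq> (\<Union>i\<in>{0..N}. {x\<in>A. w x = i} \<times> {y\<in>B. v y = N - i})"
    by auto
qed (use assms in auto)

lemma wsum_mult:
  assumes "\<And>N. finite {x\<in>A. w x = N}" "\<And>N. finite {y\<in>B. v y = N}"
  shows "wsum A c w * wsum B d v = wsum (A \<times> B) (\<lambda>(x, y). c x * d y) (\<lambda>(x, y). w x + v y)"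
proof (rule fps_ext)
  fix N
  have "(wsum A c w * wsum B d v) $ N
    = (\<Sum>i=0..N. \<Sum>(x, y)\<in>{x\<in>A. w x = i} \<times> {y\<in>B. v y = N - i}. c x * d y)"
    by (simp add: fps_mult_nth wsum_nth sum_product sum.cartesian_product)
  also have "\<dots> = (\<Sum>(x, y)\<in>(\<Union>i\<in>{0..N}. {x\<in>A. w x = i} \<times> {y\<in>B. v y = N - i}). c x * d y)"
    by (rule sum.UNION_disjoint[symmetric]) (use assms in auto)
  also have "(\<Union>i\<in>{0..N}. {x\<in>A. w x = i} \<times> {y\<in>B. v y = N - i})
    = {z\<in>A \<times> B. (case z of (x, y) \<Rightarrow> w x + v y) = N}"
    by auto
  finally show "(wsum A c w * wsum B d v) $ N = wsum (A \<times> B) (\<lambda>(x, y). c x * d y) (\<lambda>(x, y). w x + v y) $ N"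
    by (simp add: wsum_nth)
qed

lemma wsum_reindex:
  assumes "\<And>a. a \<in> A \<Longrightarrow> i (j a) = a" "\<And>a. a \<in> A \<Longrightarrow> j a \<in> B"
    and "\<And>b. b \<in> B \<Longrightarrow> j (i b) = b" "\<And>b. b \<in> B \<Longrightarrow> i b \<in> A"
    and "\<And>a. a \<in> A \<Longrightarrow> d (j a) = c a" "\<And>a. a \<in> A \<Longrightarrow> v (j a) = w a"
  shows "wsum A c w = wsum B d v"
proof (rule fps_ext)
  fix N
  have "w (i b) = v b" if "b \<in> B" for b
    using assms(3,4,6) that by metis
  then show "wsum A c w $ N = wsum B d v $ N"
    unfolding wsum_nth using assms
    by (intro sum.reindex_bij_witness[of _ i j]) auto
qed

lemma wsum_involution_eq_0:
  assumes "\<And>a. a \<in> A \<Longrightarrow> i (i a) = a" "\<And>a. a \<in> A \<Longrightarrow> i a \<in> A"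
    and "\<And>a. a \<in> A \<Longrightarrow> c (i a) = - c a" "\<And>a. a \<in> A \<Longrightarrow> w (i a) = w a"
  shows "wsum A c w = 0"
proof -
  have *: "wsum A c w = wsum A (\<lambda>a. - c a) w"
    by (rule wsum_reindex[of A i i]) (use assms in auto)
  have "wsum A c w $ N = 0" for N
    using arg_cong[OF *, of "\<lambda>f. f $ N"] by (simp add: wsum_nth sum_negf)
  then show ?thesis by (simp add: fps_eq_iff)
qed

lemma wsum_split:
  assumes "\<And>N. finite {x\<in>A. w x = N}"
  shows "wsum A c w = wsum (A \<inter> S) c w + wsum (A - S) c w"
proof (rule fps_ext)
  fix N
  have "{x\<in>A. w x = N} = {x\<in>A \<inter> S. w x = N} \<union> {x\<in>A - S. w x = N}" by auto
  moreover have "finite {x\<in>A \<inter> S. w x = N}" "finite {x\<in>A - S. w x = N}"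
    by (rule finite_subset[OF _ assms[of N]]; auto)+
  ultimately show "wsum A c w $ N = (wsum (A \<inter> S) c w + wsum (A - S) c w) $ N"
    by (simp add: wsum_nth) (subst sum.union_disjoint; auto)
qed

section \<open>The pentagonal number theorem\<close>

text \<open>The sign \<open>(-1) ^ j\<close>, extended to negative exponents.\<close>

definition alt :: "int \<Rightarrow> int" where
  "alt j = (if even j then 1 else -1)"

lemma alt_diff: "alt (i - j) = alt i * alt j"
  by (auto simp: alt_def)

lemma alt_uminus [simp]: "alt (- j) = alt j"
  by (auto simp: alt_def)

lemma alt_int: "alt (int n) = (-1) ^ n"
  by (auto simp: alt_def)

definition pent :: "int \<Rightarrow> nat" where
  "pent j = nat (j * (3 * j - 1) div 2)"

definition tri :: "int \<Rightarrow> nat" where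
  "tri j = nat (j * (j - 1) div 2)"

lemma two_pent: "2 * int (pent j) = j * (3 * j - 1)"
proof -
  have "0 \<le> j * (3 * j - 1)" by (cases "j \<le> 0") (auto intro: mult_nonpos_nonpos)
  moreover have "even (j * (3 * j - 1))" by auto
  ultimately show ?thesis by (simp add: pent_def)
qed

lemma two_tri: "2 * int (tri j) = j * (j - 1)"
proof -
  have "0 \<le> j * (j - 1)" by (cases "j \<le> 0") (auto intro: mult_nonpos_nonpos)
  moreover have "even (j * (j - 1))" by auto
  ultimately show ?thesis by (simp add: tri_def)
qed

lemma abs_le_pent: "\<bar>j\<bar> \<le> int (pent j)"
proof (cases "j \<le> 0")
  case True
  then have "0 \<le> (- j) * (- 3 * j - 1)"
    using mult_nonneg_nonneg[of "- j" "- 3 * j - 1"] by (cases "j = 0") auto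
  with True show ?thesis using two_pent[of j] by (simp add: algebra_simps)
next
  case False
  then have "0 \<le> j * (3 * j - 3)" by (auto intro!: mult_nonneg_nonneg)
  also have "j * (3 * j - 3) = 2 * int (pent j) - 2 * j"
    unfolding two_pent by (simp add: algebra_simps)
  finally show ?thesis using False by simp
qed

text \<open>Products of two consecutive integers are never negative. Both bounds are attained, and
  the truncation in \<open>euler_pow3\<close> uses them without slack.\<close>

lemma tri_ge: "i - 1 \<le> int (tri i)" "- i \<le> int (tri i)"
proof -
  have "0 \<le> (i - 1) * (i - 2)"
    by (cases "i \<le> 1") (auto intro!: mult_nonneg_nonneg mult_nonpos_nonpos)
  then show "i - 1 \<le> int (tri i)" using two_tri[of i] by (simp add: algebra_simps)
  have "0 \<le> (i + 1) * i"
    by (cases "i \<le> -1") (auto intro!: mult_nonneg_nonneg mult_nonpos_nonpos)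
  then show "- i \<le> int (tri i)" using two_tri[of i] by (simp add: algebra_simps)
qed

text \<open>Modulo \<open>q^(n+1)\<close> only the summand \<open>s = 0\<close> survives on the left-hand side.\<close>

lemma shanks_pentagonal:
  "(\<Sum>s\<le>n. (-1) ^ s * (\<Prod>k=Suc s..n. 1 - fps_X ^ k) * fps_X ^ (s * n + s * (s + 1) div 2))
   = (1 :: int fps) + (\<Sum>s=1..n. (-1) ^ s * (fps_X ^ (s * (3 * s + 1) div 2) + fps_X ^ (s * (3 * s - 1) div 2)))"
proof (induction n)
  case 0
  then show ?case by simp
next
  case (Suc n)
  define X where "X = (fps_X :: int fps)"
  define T where "T = (\<lambda>s::nat. s * (s + 1) div 2)"
  define a where "a = (\<lambda>s. (-1) ^ s * (\<Prod>k=Suc s..n. 1 - X ^ k) * X ^ (s * n + T s))"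
  \<comment> \<open>Chosen so that passing from \<open>n\<close> to \<open>Suc n\<close> changes the
    summand \<open>a s\<close> by \<open>t (Suc s) - t s\<close>. After telescoping,
    \<open>t (Suc n)\<close> is one of the two new pentagonal terms; the other is the new summand
    \<open>s = Suc n\<close>.\<close>
  define t where "t = (\<lambda>s. if s = 0 then 0 else (-1) ^ s * (\<Prod>k=s..n. 1 - X ^ k) * X ^ (s * n + T s))"
  have T: "T (Suc s) = T s + Suc s" for s
    by (simp add: T_def algebra_simps)
  have t0: "t 0 = 0" by (simp add: t_def)
  have t1: "t s = a s * (1 - X ^ s)" if "s \<le> n" for s
    using that by (cases s) (auto simp: t_def a_def prod.atLeast_Suc_atMost)
  have t2: "t (Suc s) = - (a s * X ^ (Suc n + s))" for s
    by (simp add: t_def a_def T power_add algebra_simps)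
  have split: "(\<Prod>k=Suc s..Suc n. 1 - X ^ k) = (\<Prod>k=Suc s..n. 1 - X ^ k) * (1 - X ^ Suc n)" if "s \<le> n" for s
    using that by (simp add: mult.commute)
  have "(\<Sum>s\<le>n. (-1) ^ s * (\<Prod>k=Suc s..Suc n. 1 - X ^ k) * X ^ (s * Suc n + T s))
      = (\<Sum>s\<le>n. a s + (t (Suc s) - t s))"
  proof (rule sum.cong[OF refl])
    fix s assume "s \<in> {..n}"
    then have s: "s \<le> n" by simp
    show "(-1) ^ s * (\<Prod>k=Suc s..Suc n. 1 - X ^ k) * X ^ (s * Suc n + T s) = a s + (t (Suc s) - t s)"
      unfolding t1[OF s] t2 split[OF s] by (simp add: a_def algebra_simps power_add)
  qed
  also have "\<dots> = (\<Sum>s\<le>n. a s) + t (Suc n)"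
    using sum_lessThan_telescope[of t "Suc n"] by (simp add: sum.distrib lessThan_Suc_atMost t0)
  finally have 1: "(\<Sum>s\<le>n. (-1) ^ s * (\<Prod>k=Suc s..Suc n. 1 - X ^ k) * X ^ (s * Suc n + T s))
      = (\<Sum>s\<le>n. a s) + t (Suc n)" .
  have e1: "Suc n * Suc n + T (Suc n) = Suc n * (3 * Suc n + 1) div 2"
    by (simp add: T_def algebra_simps)
  have e2: "Suc n * n + T (Suc n) = Suc n * (3 * Suc n - 1) div 2"
    by (simp add: T_def algebra_simps)
  have t: "t (Suc n) = (-1) ^ Suc n * X ^ (Suc n * (3 * Suc n - 1) div 2)"
    unfolding e2[symmetric] by (simp add: t_def)
  have "(\<Sum>s\<le>Suc n. (-1) ^ s * (\<Prod>k=Suc s..Suc n. 1 - X ^ k) * X ^ (s * Suc n + T s))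
     = (\<Sum>s\<le>n. a s) + t (Suc n) + (-1) ^ Suc n * X ^ (Suc n * (3 * Suc n + 1) div 2)"
    unfolding sum.atMost_Suc 1 e1 by simp
  also have "(\<Sum>s\<le>n. a s) = 1 + (\<Sum>s=1..n. (-1) ^ s * (X ^ (s * (3 * s + 1) div 2) + X ^ (s * (3 * s - 1) div 2)))"
    using Suc by (simp add: a_def T_def X_def)
  also have "\<dots> + t (Suc n) + (-1) ^ Suc n * X ^ (Suc n * (3 * Suc n + 1) div 2)
    = 1 + (\<Sum>s=1..Suc n. (-1) ^ s * (X ^ (s * (3 * s + 1) div 2) + X ^ (s * (3 * s - 1) div 2)))"
    unfolding t by (simp add: algebra_simps)
  finally show ?case by (simp add: T_def X_def)
qed

lemma sum_symmetric_interval: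
  "(\<Sum>j=-int n..int n. f j) = f 0 + (\<Sum>s=1..n. f (int s) + f (- int s))"
proof (induction n)
  case (Suc n)
  have "{- int (Suc n)..int (Suc n)} = insert (int (Suc n)) (insert (- int (Suc n)) {- int n..int n})"
    by auto
  then show ?case using Suc by (simp add: add_ac)
qed simp

lemma euler_pentagonal: "euler = wsum UNIV alt pent"
proof (rule fps_eqI_cong)
  fix n
  have "fps_cong 0 (Suc n) euler (qpoch n)"
    by (rule euler_cong) simp
  also have "qpoch n = (\<Sum>s\<le>n. if s = 0 then qpoch n else 0)"
    by simp
  also have "fps_cong 0 (Suc n) \<dots>
    (\<Sum>s\<le>n. (-1) ^ s * (\<Prod>k=Suc s..n. 1 - fps_X ^ k) * fps_X ^ (s * n + s * (s + 1) div 2))"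
  proof (rule fps_cong_sum)
    fix s
    show "fps_cong 0 (Suc n) (if s = 0 then qpoch n else 0)
      ((-1) ^ s * (\<Prod>k=Suc s..n. 1 - fps_X ^ k) * fps_X ^ (s * n + s * (s + 1) div 2))"
    proof (cases s)
      case 0
      then show ?thesis by (simp add: qpoch_def)
    next
      case (Suc r)
      have "Suc n \<le> s * n + s * (s + 1) div 2"
        unfolding Suc by simp
      moreover have "fps_cong 0 (Suc n) 0 (f * fps_X ^ e)" if "Suc n \<le> e" for f e
        using that by (auto simp: fps_cong_def fps_X_power_mult_right_nth)
      ultimately have "fps_cong 0 (Suc n) 0 (f * fps_X ^ (s * n + s * (s + 1) div 2))" for f
        by blast
      then show ?thesis unfolding Suc by (simp only: if_False nat.simps)
    qed
  qed
  also have "\<dots> = (\<Sum>j=-int n..int n. fps_const (alt j) * fps_X ^ pent j)"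
  proof -
    have "pent (int s) = s * (3 * s - 1) div 2" "pent (- int s) = s * (3 * s + 1) div 2" for s
    proof -
      have *: "int s * (3 * int s - 1) = int (s * (3 * s - 1))" by (cases s) (auto simp: algebra_simps)
      show "pent (int s) = s * (3 * s - 1) div 2"
        unfolding pent_def * by (simp add: zdiv_int[symmetric] del: of_nat_mult)
      have *: "- int s * (3 * - int s - 1) = int (s * (3 * s + 1))" by (simp add: algebra_simps)
      show "pent (- int s) = s * (3 * s + 1) div 2"
        unfolding pent_def * by (metis nat_int of_nat_numeral zdiv_int)
    qed
    moreover have "fps_const ((-1) ^ s) = ((-1) ^ s :: int fps)" for s
      by (metis fps_const_1_eq_1 fps_const_neg fps_const_power)
    moreover have "pent 0 = 0" "alt 0 = 1" by (simp_all add: pent_def alt_def)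
    ultimately show ?thesis
      unfolding shanks_pentagonal sum_symmetric_interval by (simp add: alt_int algebra_simps)
  qed
  also have "fps_cong 0 (Suc n) \<dots> (wsum UNIV alt pent)"
  proof (rule fps_cong_sym, rule wsum_cong_sum)
    fix j assume "pent j < Suc n"
    then show "j \<in> {- int n..int n}" using abs_le_pent[of j] by auto
  qed auto
  finally show "fps_cong 0 (Suc n) euler (wsum UNIV alt pent)" .
qed

section \<open>Jacobi's formula for the cube of Euler's product\<close>

text \<open>Gaussian binomials through the q-Pascal rule, which needs no division;
  \<open>qbinom_qpoch\<close> recovers the quotient formula.\<close>

fun qbinom :: "'a::comm_ring_1 \<Rightarrow> nat \<Rightarrow> nat \<Rightarrow> 'a" where
  "qbinom q n 0 = 1"
| "qbinom q 0 (Suc k) = 0"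
| "qbinom q (Suc n) (Suc k) = qbinom q n k + q ^ Suc k * qbinom q n (Suc k)"

lemma qbinom_eq_0: "n < k \<Longrightarrow> qbinom q n k = 0"
  by (induction q n k rule: qbinom.induct) auto

text \<open>Peeling off the factor \<open>i = 0\<close> turns \<open>z\<close> into
  \<open>z * q\<close> in the rest, hence the induction over arbitrary \<open>z\<close>. The
  homogeneous form with \<open>y\<close> permits \<open>y = q ^ n\<close> later, so that no negative
  powers of \<open>q\<close> arise.\<close>

lemma qbinom_theorem:
  "coeff (\<Prod>i<N. [:y, z * q ^ i:]) k = q ^ (k choose 2) * qbinom q N k * z ^ k * y ^ (N - k)"
proof (induction N arbitrary: z k)
  case 0
  then show ?case by (cases k) (auto simp: coeff_1 numeral_2_eq_2)
next
  case (Suc N)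
  have "(\<Prod>i<Suc N. [:y, z * q ^ i:]) = [:y, z:] * (\<Prod>i<N. [:y, (z * q) * q ^ i:])"
    by (simp only: prod.lessThan_Suc_shift power_0 mult_1_right mult_1_left power_Suc mult_ac)
  then have *: "coeff (\<Prod>i<Suc N. [:y, z * q ^ i:]) k =
     coeff ([:y, z:] * (\<Prod>i<N. [:y, (z * q) * q ^ i:])) k" for k by simp
  show ?case
  proof (cases k)
    case 0
    then show ?thesis unfolding * by (simp add: Suc.IH)
  next
    case (Suc k')
    have ch: "Suc k' choose 2 = (k' choose 2) + k'"
      by (simp add: numeral_2_eq_2)
    have lin: "coeff ([:y, z:] * r) (Suc k') = y * coeff r (Suc k') + z * coeff r k'" for r
      by simp
    show ?thesis
    proof (cases "Suc k' \<le> N")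
      case True
      then have "N - k' = Suc (N - Suc k')" by simp
      then show ?thesis unfolding Suc * lin Suc.IH ch
        by (simp add: power_add power_mult_distrib algebra_simps)
    next
      case False
      then show ?thesis unfolding Suc * lin Suc.IH ch
        by (simp add: power_add power_mult_distrib algebra_simps qbinom_eq_0)
    qed
  qed
qed

text \<open>The two terms of the Pascal rule contribute \<open>1 - q ^ Suc k'\<close> and
  \<open>q ^ Suc k' * (1 - q ^ (n - k'))\<close> times \<open>qpoch n\<close>, together
  \<open>1 - q ^ Suc n\<close>. For \<open>k' = n\<close> the second one is 0.\<close>

lemma qbinom_qpoch:
  "k \<le> n \<Longrightarrow> qbinom fps_X n k * qpoch k * qpoch (n - k) = qpoch n"
proof (induction n arbitrary: k)
  case (Suc n)
  show ?case
  proof (cases k)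
    case (Suc k')
    with Suc.prems have k': "k' \<le> n" by simp
    have IH1: "qbinom fps_X n k' * qpoch k' * qpoch (n - k') = qpoch n"
      using Suc.IH[OF k'] .
    have "qbinom fps_X n (Suc k') * qpoch (Suc k') * qpoch (n - k') = qpoch n * (1 - fps_X ^ (n - k'))"
    proof (cases "k' = n")
      case True
      then show ?thesis by (simp add: qbinom_eq_0)
    next
      case False
      with k' have "n - k' = Suc (n - Suc k')" "Suc k' \<le> n" by auto
      then show ?thesis
        using Suc.IH[of "Suc k'"] by (simp only: qpoch_Suc[of "n - Suc k'"] mult.assoc[symmetric])
    qed
    note IH2 = this
    have "qbinom fps_X (Suc n) (Suc k') * qpoch (Suc k') * qpoch (n - k') =
      qbinom fps_X n k' * qpoch k' * qpoch (n - k') * (1 - fps_X ^ Suc k') +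
      fps_X ^ Suc k' * (qbinom fps_X n (Suc k') * qpoch (Suc k') * qpoch (n - k'))"
      by (simp add: algebra_simps)
    also have "\<dots> = qpoch n * (1 - fps_X ^ Suc k' * fps_X ^ (n - k'))"
      unfolding IH1 IH2 by (simp add: algebra_simps)
    also have "fps_X ^ Suc k' * fps_X ^ (n - k') = fps_X ^ Suc n"
      using k' by (simp flip: power_add power_Suc)
    finally show ?thesis using Suc by simp
  qed simp
qed simp

text \<open>Indices below \<open>n\<close> give \<open>- X ^ i * (1 - X ^ (n - i))\<close>, those
  above give \<open>X ^ n * (1 - X ^ (i - n))\<close>; each half supplies one factor
  \<open>qpoch n\<close>.\<close>

lemma prod_X_power_diff:
  "(\<Prod>i\<in>{..<2 * n + 1} - {n}. fps_X ^ n - fps_X ^ i)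
    = (-1) ^ n * fps_X ^ ((n choose 2) + n * n) * qpoch n ^ 2"
proof -
  define X where "X = (fps_X :: int fps)"
  have U: "{..<2 * n + 1} - {n} = {..<n} \<union> (+) n ` {1..n}"
  proof -
    have "x \<in> (+) n ` {1..n}" if "n < x" "x < 2 * n + 1" for x
      using that by (intro image_eqI[of _ _ "x - n"]) auto
    then show ?thesis by force
  qed
  have "(\<Prod>i\<in>{..<2 * n + 1} - {n}. X ^ n - X ^ i) = (\<Prod>i<n. X ^ n - X ^ i) * (\<Prod>i\<in>(+) n ` {1..n}. X ^ n - X ^ i)"
    unfolding U by (rule prod.union_disjoint) auto
  also have "(\<Prod>i\<in>(+) n ` {1..n}. X ^ n - X ^ i) = (\<Prod>i=1..n. X ^ n * (1 - X ^ i))"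
    by (subst prod.reindex) (auto simp: power_add algebra_simps)
  also have "\<dots> = X ^ (n * n) * qpoch n"
    by (simp add: prod.distrib qpoch_def X_def power_mult)
  also have "(\<Prod>i<n. X ^ n - X ^ i) = (\<Prod>i<n. - 1 * X ^ i * (1 - X ^ (n - i)))"
  proof (rule prod.cong[OF refl])
    fix i assume "i \<in> {..<n}"
    then have "X ^ n = X ^ i * X ^ (n - i)" by (simp flip: power_add)
    then show "X ^ n - X ^ i = - 1 * X ^ i * (1 - X ^ (n - i))" by (simp add: algebra_simps)
  qed
  also have "\<dots> = (-1) ^ n * X ^ (\<Sum>i<n. i) * (\<Prod>i<n. 1 - X ^ (n - i))"
    by (simp only: prod.distrib power_sum prod_constant card_lessThan)
  also have "(\<Prod>i<n. 1 - X ^ (n - i)) = qpoch n"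
    unfolding qpoch_def X_def
    by (rule prod.reindex_bij_witness[of _ "\<lambda>i. n - i" "\<lambda>i. n - i"]) auto
  also have "(\<Sum>i<n. i) = n choose 2"
    by (induction n) (auto simp: numeral_2_eq_2)
  finally show ?thesis
    by (simp add: X_def power_add power2_eq_square mult_ac)
qed

lemma pderiv_sum: "pderiv (sum f S) = (\<Sum>x\<in>S. pderiv (f x))"
  by (induction S rule: infinite_finite_induct) (simp_all add: pderiv_add)

text \<open>The derivative at \<open>x = 1\<close> of the \<open>q\<close>-binomial theorem for the product of \<open>q^n - x q^i\<close> over
  \<open>i \<le> 2n\<close>, whose factor with \<open>i = n\<close> vanishes there.\<close>

lemma jacobi_cube_finite:
  "(\<Sum>i=-int n..int n+1. fps_const (alt i * i) * fps_X ^ tri i * qbinom fps_X (2 * n + 1) (nat (int n + 1 - i)))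
   = - (qpoch n ^ 2)"
proof -
  define X where "X = (fps_X :: int fps)"
  define N where "N = 2 * n + 1"
  \<comment> \<open>The power of \<open>X\<close> common to all coefficients of \<open>P\<close>:
    the exponent \<open>(k choose 2) + n * (N - k)\<close> exceeds \<open>M\<close> by the
    triangular number at \<open>n + 1 - k\<close>.\<close>
  define M where "M = n + n * n + (n choose 2)"
  define P where "P = (\<Prod>i<N. [:X ^ n, (-1) * X ^ i:])"
  define c where "c = (\<lambda>k. (-1) ^ k * X ^ tri (int n + 1 - int k) * qbinom X N k)"
  have coeff_P: "coeff P k = X ^ M * c k" if "k \<le> N" for k
  proof -
    have ch: "2 * (r choose 2) + r = r * r" for r :: nat
      by (induction r) (auto simp: numeral_2_eq_2)
    have Nk: "int (N - k) = 2 * int n + 1 - int k" using that by (simp add: N_def)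
    have "2 * int ((k choose 2) + n * (N - k)) = 2 * int (M + tri (int n + 1 - int k))"
      unfolding of_nat_add of_nat_mult Nk using two_tri[of "int n + 1 - int k"] arg_cong[OF ch[of k], of int] arg_cong[OF ch[of n], of int]
      by (simp add: M_def algebra_simps)
    then have "(k choose 2) + n * (N - k) = M + tri (int n + 1 - int k)"
      by (metis mult_cancel_left of_nat_eq_iff zero_neq_numeral)
    then have "X ^ (k choose 2) * (X ^ n) ^ (N - k) = X ^ M * X ^ tri (int n + 1 - int k)"
      by (metis power_add power_mult)
    then show ?thesis
      unfolding P_def qbinom_theorem c_def by (simp add: mult_ac)
  qed
  have "degree P \<le> N"
    unfolding P_def by (rule degree_le, unfold qbinom_theorem) (simp add: qbinom_eq_0)
  then have P_sum: "P = (\<Sum>k\<le>N. monom (X ^ M * c k) k)"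
    using poly_as_sum_of_monoms'[of P N] coeff_P by simp
  have P_split: "P = [:X ^ n, - (X ^ n):] * (\<Prod>i\<in>{..<N} - {n}. [:X ^ n, (-1) * X ^ i:])"
    unfolding P_def by (subst prod.remove[of _ n]) (auto simp: N_def)
  have "poly P 1 = 0"
    unfolding P_split by simp
  then have "(\<Sum>k\<le>N. X ^ M * c k) = 0"
    unfolding P_sum by (simp add: poly_sum poly_monom)
  \<comment> \<open>Because of this relation the weight \<open>k\<close> produced by the derivative
    may be traded for \<open>i = n + 1 - k\<close>.\<close>
  then have sum0: "(\<Sum>k\<le>N. c k) = 0"
    by (simp add: X_def flip: sum_distrib_left)
  have "poly (pderiv P) 1 = - (X ^ n) * (\<Prod>i\<in>{..<N} - {n}. X ^ n - X ^ i)"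
    unfolding P_split pderiv_mult poly_add poly_mult by (simp add: pderiv_pCons poly_prod)
  also have "\<dots> = X ^ M * ((-1) ^ Suc n * qpoch n ^ 2)"
    unfolding X_def N_def prod_X_power_diff by (simp add: M_def power_add mult_ac)
  finally have "X ^ M * ((-1) ^ Suc n * qpoch n ^ 2) = poly (pderiv P) 1" ..
  also have "\<dots> = X ^ M * (\<Sum>k\<le>N. of_nat k * c k)"
    unfolding P_sum
    by (simp add: pderiv_sum poly_sum pderiv_monom poly_monom sum_distrib_left mult_ac)
  finally have sum1: "(-1) ^ Suc n * qpoch n ^ 2 = (\<Sum>k\<le>N. of_nat k * c k)"
    by (rule mult_left_cancel[THEN iffD1, rotated]) (simp add: X_def)
  have "(\<Sum>i=-int n..int n+1. fps_const (alt i * i) * X ^ tri i * qbinom X N (nat (int n + 1 - i)))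
      = (\<Sum>k\<le>N. (-1) ^ Suc n * ((of_nat n + 1) * c k - of_nat k * c k))"
  proof (rule sum.reindex_bij_witness[of _ "\<lambda>k. int n + 1 - int k" "\<lambda>i. nat (int n + 1 - i)"])
    fix i assume i: "i \<in> {-int n..int n+1}"
    define k where "k = nat (int n + 1 - i)"
    have ik: "i = int (Suc n) - int k" using i by (simp add: k_def)
    have tri_k: "tri (int n + 1 - int k) = tri i" by (simp add: ik add.commute)
    have const: "fps_const (alt i * i) = ((-1) ^ Suc n * (-1) ^ k * (of_nat n + 1 - of_nat k) :: int fps)"
    proof -
      have "alt i * i = (-1) ^ Suc n * (-1) ^ k * (int n + 1 - int k)"
        unfolding ik alt_diff alt_int by simp
      then have "fps_const (alt i * i) = of_int ((-1) ^ Suc n * (-1) ^ k * (int n + 1 - int k))"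
        by (simp only: fps_of_int[symmetric] of_int_eq_id id_def)
      then show ?thesis by simp
    qed
    show "(-1) ^ Suc n * ((of_nat n + 1) * c (nat (int n + 1 - i)) - of_nat (nat (int n + 1 - i)) * c (nat (int n + 1 - i)))
       = fps_const (alt i * i) * X ^ tri i * qbinom X N (nat (int n + 1 - i))"
      unfolding k_def[symmetric] c_def tri_k const by (simp add: algebra_simps)
  qed (auto simp: N_def)
  also have "\<dots> = (-1) ^ Suc n * ((of_nat n + 1) * (\<Sum>k\<le>N. c k) - (\<Sum>k\<le>N. of_nat k * c k))"
    by (simp only: sum_distrib_left sum_subtractf right_diff_distrib)
  also have "\<dots> = - (qpoch n ^ 2)"
    unfolding sum0 sum1[symmetric] by (simp flip: power_mult_distrib mult.assoc)
  finally show ?thesis by (simp add: X_def N_def)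
qed

text \<open>Multiplying the finite identity by \<open>euler ^ 2\<close> clears the denominators of
  the Gaussian binomials, each of which tends to the inverse of \<open>euler\<close>. The limit is
  an identity for \<open>euler ^ 4\<close>, from which one \<open>euler\<close> cancels.\<close>

lemma euler_pow3: "euler ^ 3 = - wsum UNIV (\<lambda>i. alt i * i) tri"
proof -
  let ?J = "wsum UNIV (\<lambda>i. alt i * i) tri"
  have "euler ^ 4 = - (?J * euler)"
  proof (rule fps_eqI_cong)
    fix n
    have "fps_cong 0 (Suc n) (euler ^ 2 * euler ^ 2) (euler ^ 2 * qpoch n ^ 2)"
      by (intro fps_cong_mult fps_cong_pow euler_cong fps_cong_refl) simp
    then have "fps_cong 0 (Suc n) (euler ^ 4) (euler ^ 2 * qpoch n ^ 2)"
      by (simp flip: power_add)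
    also have "euler ^ 2 * qpoch n ^ 2 = euler ^ 2 * - (\<Sum>i=-int n..int n+1. fps_const (alt i * i) *
       fps_X ^ tri i * qbinom fps_X (2 * n + 1) (nat (int n + 1 - i)))"
      unfolding jacobi_cube_finite by simp
    also have "\<dots> = - (\<Sum>i=-int n..int n+1. fps_const (alt i * i) *
       (fps_X ^ tri i * (qbinom fps_X (2 * n + 1) (nat (int n + 1 - i)) * euler ^ 2)))"
      by (simp add: sum_distrib_left mult_ac)
    also have "fps_cong 0 (Suc n) \<dots> (- (\<Sum>i=-int n..int n+1. fps_const (alt i * i) * (fps_X ^ tri i * euler)))"
    proof (intro fps_cong_uminus fps_cong_sum, rule fps_cong_mult[OF fps_cong_refl])
      fix i assume i: "i \<in> {-int n..int n+1}"
      define k where "k = nat (int n + 1 - i)"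
      define l where "l = 2 * n + 1 - k"
      have kl: "int k = int n + 1 - i" "int l = int n + i" using i by (auto simp: k_def l_def)
      have k: "k \<le> 2 * n + 1" using kl by linarith
      \<comment> \<open>The binomial is accurate only to order \<open>min k l + 1\<close>, which is
        poor near the ends of the range of \<open>i\<close>. The factor \<open>fps_X ^ tri i\<close>
        makes up for it: \<open>tri i + k\<close> and \<open>tri i + l\<close> are both at least
        \<open>n\<close>.\<close>
      define a where "a = Suc (min k l)"
      have a: "a \<le> Suc k" "a \<le> Suc l" by (auto simp: a_def)
      have "fps_cong 0 a (qbinom fps_X (2 * n + 1) k * euler ^ 2)
              (qbinom fps_X (2 * n + 1) k * (qpoch k * qpoch l))"
        unfolding power2_eq_square by (intro fps_cong_mult fps_cong_refl euler_cong a)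
      also have "\<dots> = qpoch (2 * n + 1)"
        using qbinom_qpoch[OF k] by (simp only: l_def mult.assoc)
      also have "fps_cong 0 a \<dots> euler"
        by (rule fps_cong_sym, rule euler_cong) (use a k in simp)
      finally have "fps_cong 0 (tri i + a) (fps_X ^ tri i * (qbinom fps_X (2 * n + 1) k * euler ^ 2)) (fps_X ^ tri i * euler)"
        by (rule fps_cong_X_power_mult)
      moreover have "Suc n \<le> tri i + a"
        using tri_ge[of i] kl by (auto simp: a_def)
      ultimately show "fps_cong 0 (Suc n) (fps_X ^ tri i * (qbinom fps_X (2 * n + 1) (nat (int n + 1 - i)) * euler ^ 2)) (fps_X ^ tri i * euler)"
        unfolding k_def by (rule fps_cong_mono)
    qed
    also have "- (\<Sum>i=-int n..int n+1. fps_const (alt i * i) * (fps_X ^ tri i * euler))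
       = - ((\<Sum>i=-int n..int n+1. fps_const (alt i * i) * fps_X ^ tri i) * euler)"
      by (simp only: sum_distrib_right mult.assoc)
    also have "fps_cong 0 (Suc n) \<dots> (- (?J * euler))"
    proof (intro fps_cong_uminus fps_cong_mult fps_cong_refl)
      have "i \<in> {-int n..int n+1}" if "tri i < Suc n" for i
        using that tri_ge[of i] by auto
      then show "fps_cong 0 (Suc n) (\<Sum>i=-int n..int n+1. fps_const (alt i * i) * fps_X ^ tri i) ?J"
        by (intro fps_cong_sym[OF wsum_cong_sum]) auto
    qed
    finally show "fps_cong 0 (Suc n) (euler ^ 4) (- (?J * euler))" .
  qed
  then have "euler * (euler ^ 3) = euler * (- ?J)"
    by (simp add: eval_nat_numeral mult_ac)
  then show ?thesis using euler_nz by (metis mult_left_cancel)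
qed

section \<open>The eighth power of Euler's product\<close>

lemma finite_fibres_tri: "finite {i\<in>UNIV. tri i = N}"
proof (rule finite_subset)
  show "{i\<in>UNIV. tri i = N} \<subseteq> {- int N..int N + 1}"
  proof
    fix i assume "i \<in> {i\<in>UNIV. tri i = N}"
    then show "i \<in> {- int N..int N + 1}" using tri_ge[of i] by auto
  qed
qed simp

lemma finite_fibres_pent: "finite {i\<in>UNIV. pent i = N}"
proof (rule finite_subset)
  show "{i\<in>UNIV. pent i = N} \<subseteq> {- int N..int N}"
  proof
    fix i assume "i \<in> {i\<in>UNIV. pent i = N}"
    then show "i \<in> {- int N..int N}" using abs_le_pent[of i] by auto
  qed
qed simp

definition tri3 :: "int \<times> int \<times> int \<Rightarrow> nat" where
  "tri3 = (\<lambda>(l, m, n). tri l + (tri m + tri n))"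

lemma finite_fibres_tri3: "finite {z\<in>UNIV. tri3 z = N}"
proof -
  have 2: "finite {z\<in>UNIV \<times> UNIV. (case z of (x, y) \<Rightarrow> tri x + tri y) = N}" for N
    by (intro finite_fibres_Times finite_fibres_tri)
  have 3: "finite {z\<in>UNIV \<times> (UNIV \<times> UNIV). (case z of (x, y) \<Rightarrow> tri x + (case y of (m, n) \<Rightarrow> tri m + tri n)) = N}" for N
    by (intro finite_fibres_Times finite_fibres_tri 2)
  then show ?thesis by (simp add: tri3_def case_prod_unfold)
qed

text \<open>The weight depends only on differences, so it is constant along the lines summed over
  later. Of its monomials only \<open>- 2 * l * m * n\<close> involves all three variables.\<close>

lemma two_euler_pow9:
  "wsum UNIV (\<lambda>(l, m, n). alt l * alt m * alt n * ((l - n)\<^sup>2 * (m - n))) tri3 = 2 * euler ^ 9"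
proof -
  define M where "M = (\<lambda>k::nat. wsum UNIV (\<lambda>i. alt i * i ^ k) tri)"
  define F where "F = (\<lambda>a b c::nat. wsum UNIV (\<lambda>(l, m, n). alt l * l ^ a * (alt m * m ^ b * (alt n * n ^ c))) tri3)"
  have F: "F a b c = M a * (M b * M c)" for a b c
  proof -
    have "finite {z\<in>UNIV \<times> UNIV. (case z of (x, y) \<Rightarrow> tri x + tri y) = N}" for N
      by (intro finite_fibres_Times finite_fibres_tri)
    then show ?thesis
      unfolding M_def F_def by (simp add: wsum_mult finite_fibres_tri[simplified] tri3_def case_prod_unfold)
  qed
  \<comment> \<open>The reflection \<open>i\<close> to \<open>1 - i\<close> keeps \<open>tri\<close>
    and changes parity, so the unweighted alternating series cancels.\<close>
  have "tri (1 - i) = tri i" for i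
    using two_tri[of i] two_tri[of "1 - i"] by (simp add: algebra_simps)
  then have M0: "M 0 = 0"
    unfolding M_def by (intro wsum_involution_eq_0[of _ "\<lambda>i. 1 - i"]) (auto simp: alt_def)
  have M1: "M 1 = - (euler ^ 3)"
    using euler_pow3 by (simp add: M_def)
  have "wsum UNIV (\<lambda>(l, m, n). alt l * alt m * alt n * ((l - n)\<^sup>2 * (m - n))) tri3
    = F 2 1 0 - F 2 0 1 - F 1 1 1 - F 1 1 1 + F 1 0 2 + F 1 0 2 + F 0 1 2 - F 0 0 3"
    unfolding F_def
    by (rule fps_ext, unfold fps_add_nth fps_sub_nth wsum_nth sum.distrib[symmetric] sum_subtractf[symmetric],
        rule sum.cong[OF refl]) (auto simp: power2_eq_square power3_eq_cube algebra_simps)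
  also have "\<dots> = 2 * euler ^ 9"
    unfolding F M0 M1 by (simp flip: power_add)
  finally show ?thesis .
qed

text \<open>The norm of the Eisenstein integer with coordinates \<open>u\<close> and
  \<open>v\<close> relative to 1 and a primitive cube root of unity.\<close>

definition qform :: "int \<times> int \<Rightarrow> int" where
  "qform = (\<lambda>(u, v). u\<^sup>2 - u * v + v\<^sup>2)"

definition lat :: "(int \<times> int) set" where
  "lat = {(u, v). \<not> 3 dvd u + v}"

definition qexp :: "int \<times> int \<Rightarrow> nat" where
  "qexp z = nat ((qform z - 1) div 3)"

lemma qform_bound: "u\<^sup>2 \<le> 2 * qform (u, v)" "v\<^sup>2 \<le> 2 * qform (u, v)"
proof -
  have "2 * qform (u, v) = u\<^sup>2 + v\<^sup>2 + (u - v)\<^sup>2"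
    by (simp add: qform_def power2_eq_square algebra_simps)
  then show "u\<^sup>2 \<le> 2 * qform (u, v)" "v\<^sup>2 \<le> 2 * qform (u, v)"
    by simp_all
qed

text \<open>The form is \<open>(u + v)\<^sup>2 - 3 * u * v\<close>, hence 1 modulo 3 on
  \<open>lat\<close>; being nonnegative it is then at least 1. So neither \<open>div\<close> nor
  \<open>nat\<close> in \<open>qexp\<close> loses anything there.\<close>

lemma qexp:
  assumes "z \<in> lat"
  shows "qform z = 3 * int (qexp z) + 1"
proof -
  obtain u v where z: "z = (u, v)" by force
  define w where "w = u + v"
  have "qform z = w\<^sup>2 - 3 * (u * v)"
    by (simp add: z qform_def w_def power2_eq_square algebra_simps)
  moreover have "w\<^sup>2 mod 3 = 1"
  proof -
    have "w mod 3 = 1 \<or> w mod 3 = 2"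
      using assms by (auto simp: lat_def z w_def) presburger
    then show ?thesis
      by (auto simp: power2_eq_square mod_mult_eq[of w 3 w, symmetric])
  qed
  ultimately have 3: "3 dvd qform z - 1" by presburger
  have "0 \<le> qform z"
    using qform_bound(1)[of u v] zero_le_power2[of u] unfolding z by linarith
  with 3 have "0 \<le> qform z - 1" by presburger
  with 3 show ?thesis by (auto simp: qexp_def)
qed

lemma finite_fibres_qexp: "finite {z\<in>lat. qexp z = N}"
proof (rule finite_subset)
  define K where "K = 6 * int N + 2"
  have abs: "\<bar>u\<bar> \<le> K" if "u\<^sup>2 \<le> K" for u
  proof -
    have "\<bar>u\<bar> * 1 \<le> \<bar>u\<bar> * \<bar>u\<bar>" by (cases "u = 0") (simp, rule mult_left_mono, simp_all)
    also have "\<dots> = u\<^sup>2" by (simp add: power2_eq_square)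
    finally show ?thesis using that by simp
  qed
  show "{z\<in>lat. qexp z = N} \<subseteq> {-K..K} \<times> {-K..K}"
  proof
    fix z assume "z \<in> {z\<in>lat. qexp z = N}"
    moreover obtain u v where z: "z = (u, v)" by force
    ultimately have uv: "(u, v) \<in> lat" "N = qexp (u, v)" by auto
    have "2 * qform (u, v) = K" using qexp[OF uv(1)] by (simp add: K_def uv(2))
    then have "\<bar>u\<bar> \<le> K" "\<bar>v\<bar> \<le> K" using qform_bound[where u = u and v = v] abs by auto
    then show "z \<in> {-K..K} \<times> {-K..K}" by (auto simp: z)
  qed
qed simp

text \<open>The sign is what remains of \<open>alt l * alt m * alt n\<close> once the sign of the
  pentagonal series has been split off.\<close>

definition latcoeff :: "int \<times> int \<Rightarrow> int" where
  "latcoeff = (\<lambda>(u, v). alt u * alt v * alt ((u + v) div 3) * (u\<^sup>2 * v))"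

lemma two_tri3: "2 * int (tri3 (l, m, n)) = l * (l - 1) + m * (m - 1) + n * (n - 1)"
  by (simp add: tri3_def two_tri)

lemma euler_pow8: "2 * euler ^ 8 = wsum lat latcoeff qexp"
proof -
  define c where "c = (\<lambda>(l, m, n). alt l * alt m * alt n * ((l - n)\<^sup>2 * (m - n)))"
  define S where "S = {(l, m, n :: int). 3 dvd (l - n) + (m - n)}"
  have "2 * euler ^ 9 = wsum S c tri3 + wsum (- S) c tri3"
    using wsum_split[OF finite_fibres_tri3, of c S] two_euler_pow9
    by (simp add: c_def Compl_eq_Diff_UNIV)
  also have "wsum S c tri3 = 0"
  proof (rule wsum_involution_eq_0)
    \<comment> \<open>On a line with \<open>u + v = 3 * k\<close>, twice the exponent is
      \<open>3 * n\<^sup>2 + (6 * k - 3) * n\<close> plus a constant, symmetric under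
      \<open>n\<close> to \<open>1 - 2 * k - n\<close>. The resulting shift \<open>d\<close> is odd
      and moves three coordinates, so the sign flips.\<close>
    define i where "i = (\<lambda>(l, m, n :: int). let d = 1 - 2 * (((l - n) + (m - n)) div 3) - 2 * n in (l + d, m + d, n + d))"
    have i: "i (l, m, n) = (l + d, m + d, n + d)" if "(l - n) + (m - n) = 3 * k" "d = 1 - 2 * k - 2 * n" for l m n k d
      unfolding i_def prod.case Let_def that by simp
    fix z assume "z \<in> S"
    moreover obtain l m n where z: "z = (l, m, n)" by (cases z)
    ultimately obtain k where k: "(l - n) + (m - n) = 3 * k" by (auto simp: S_def)
    define d where "d = 1 - 2 * k - 2 * n"
    have m: "m = 3 * k - l + 2 * n" using k by simp
    have iz: "i z = (l + d, m + d, n + d)"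
      unfolding z by (rule i[OF k d_def])
    have "i (i z) = (l + d + - d, m + d + - d, n + d + - d)"
      unfolding iz by (rule i[of _ _ _ k]) (use k in \<open>simp_all add: d_def\<close>)
    then show "i (i z) = z" by (simp add: z)
    have "(l + d - (n + d)) + (m + d - (n + d)) = 3 * k" using k by simp
    then show "i z \<in> S" unfolding iz S_def mem_Collect_eq prod.case by (rule dvdI)
    have "odd d" by (simp add: d_def)
    then have "alt (l + d) * alt (m + d) * alt (n + d) = - (alt l * alt m * alt n)"
      by (auto simp: alt_def)
    then show "c (i z) = - c z"
      unfolding iz unfolding z c_def by simp
    have "2 * int (tri3 (i z)) = 2 * int (tri3 z)"
      unfolding iz unfolding z two_tri3 by (simp add: d_def m algebra_simps)
    then show "tri3 (i z) = tri3 z" by simp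
  qed
  also have "wsum (- S) c tri3 = wsum (lat \<times> UNIV) (\<lambda>(x, y). latcoeff x * alt y) (\<lambda>(x, y). qexp x + pent y)"
  proof (rule wsum_reindex)
    \<comment> \<open>A line with \<open>u + v\<close> congruent to \<open>2\<close> is traversed backwards, since its exponents are those of \<open>pent (- r)\<close>.\<close>
    define s where "s = (\<lambda>w::int. if w mod 3 = 1 then 1 else - 1 :: int)"
    \<comment> \<open>Up to the orientation \<open>s\<close>, the shift of \<open>n\<close> by
      \<open>(u + v) div 3\<close> turns the exponent, quadratic in \<open>n\<close> along a line,
      into a pentagonal number plus the constant \<open>qexp (u, v)\<close>.\<close>
    define i where "i = (\<lambda>((u, v), r). let n = s (u + v) * r - (u + v) div 3 in (u + n, v + n, n))"
    define j where "j = (\<lambda>(l, m, n). ((l - n, m - n), s ((l - n) + (m - n)) * (n + ((l - n) + (m - n)) div 3)))"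
    have ss: "s w * (s w * x) = x" for w x by (simp add: s_def)
    show "j (i b) = b" if "b \<in> lat \<times> UNIV" for b
      by (auto simp: i_def j_def Let_def ss split: prod.splits)
    show "i b \<in> - S" if "b \<in> lat \<times> UNIV" for b
      using that by (auto simp: i_def S_def lat_def Let_def)
    fix a assume "a \<in> - S"
    moreover obtain l m n where a: "a = (l, m, n)" by (cases a)
    ultimately have nd: "\<not> 3 dvd (l - n) + (m - n)" by (auto simp: S_def)
    define u where "u = l - n"
    define v where "v = m - n"
    define k where "k = (u + v) div 3"
    define r where "r = s (u + v) * (n + k)"
    have ja: "j a = ((u, v), r)" by (simp add: a j_def r_def k_def u_def v_def)
    have lat: "(u, v) \<in> lat" using nd by (simp add: lat_def u_def v_def)
    show "i (j a) = a"
      unfolding ja by (simp add: i_def r_def ss Let_def flip: k_def) (simp add: a u_def v_def)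
    show "j a \<in> lat \<times> UNIV" using lat by (simp add: ja)
    have "alt r = alt n * alt k" by (auto simp: r_def s_def alt_def)
    then have "alt u * alt v * alt k * alt r = alt l * alt m * alt n"
      by (auto simp: u_def v_def alt_def)
    moreover have "c a = alt l * alt m * alt n * (u\<^sup>2 * v)"
      by (simp add: a c_def u_def v_def)
    ultimately show "(case j a of (x, y) \<Rightarrow> latcoeff x * alt y) = c a"
      unfolding ja by (simp add: latcoeff_def flip: k_def)
    have w: "(s (u + v) = 1 \<and> v = 3 * k + 1 - u) \<or> (s (u + v) = - 1 \<and> v = 3 * k + 2 - u)"
      using lat unfolding s_def k_def lat_def by auto presburger+
    have lm: "l = u + n" "m = v + n" by (simp_all add: u_def v_def)
    have q: "3 * int (qexp (u, v)) = u\<^sup>2 - u * v + v\<^sup>2 - 1"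
      using qexp[OF lat] by (simp add: qform_def)
    \<comment> \<open>The factor 6 clears the division by 3 in \<open>qexp\<close> and by 2 in
      \<open>pent\<close> and \<open>tri\<close>, leaving one polynomial identity for each residue
      of \<open>u + v\<close>.\<close>
    have "6 * int (qexp (u, v) + pent r) = 2 * (3 * int (qexp (u, v))) + 3 * (2 * int (pent r))"
      by simp
    also have "\<dots> = 3 * (2 * int (tri3 a))"
      unfolding q two_pent a two_tri3 lm r_def using w
    proof (elim disjE conjE)
      assume s1: "s (u + v) = 1" and v1: "v = 3 * k + 1 - u"
      show "2 * (u\<^sup>2 - u * v + v\<^sup>2 - 1) + 3 * (s (u + v) * (n + k) * (3 * (s (u + v) * (n + k)) - 1))
        = 3 * ((u + n) * (u + n - 1) + (v + n) * (v + n - 1) + n * (n - 1))"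
        unfolding s1 unfolding v1 by (simp add: power2_eq_square algebra_simps)
    next
      assume s1: "s (u + v) = - 1" and v1: "v = 3 * k + 2 - u"
      show "2 * (u\<^sup>2 - u * v + v\<^sup>2 - 1) + 3 * (s (u + v) * (n + k) * (3 * (s (u + v) * (n + k)) - 1))
        = 3 * ((u + n) * (u + n - 1) + (v + n) * (v + n - 1) + n * (n - 1))"
        unfolding s1 unfolding v1 by (simp add: power2_eq_square algebra_simps)
    qed
    finally show "(case j a of (x, y) \<Rightarrow> qexp x + pent y) = tri3 a"
      unfolding ja by simp
  qed
  also have "\<dots> = wsum lat latcoeff qexp * euler"
    unfolding euler_pentagonal by (rule wsum_mult[symmetric, OF finite_fibres_qexp finite_fibres_pent])
  finally have "2 * euler ^ 8 * euler = wsum lat latcoeff qexp * euler"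
    by (simp add: mult.assoc flip: power_Suc2)
  then show ?thesis using euler_nz by simp
qed

lemma euler_pow8_eq_0:
  assumes "\<And>u v. qform (u, v) \<noteq> 3 * int N + 1"
  shows "(euler ^ 8) $ N = 0"
proof -
  have empty: "{z\<in>lat. qexp z = N} = {}"
    using assms qexp by force
  have "(2 * euler ^ 8) $ N = 0"
    unfolding euler_pow8 wsum_nth empty by simp
  then show ?thesis by (simp add: numeral_fps_const)
qed

section \<open>The norm form and primes congruent to 2 modulo 3\<close>

lemma fermat_int:
  assumes "prime p"
  shows "[u ^ p = u] (mod int p)"
proof -
  define a where "a = nat (u mod int p)"
  have p: "0 < p" using assms prime_gt_0_nat by blast
  have a: "[u = int a] (mod int p)"
    using p by (simp add: a_def cong_def)
  have "[a ^ p = a] (mod p)"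
  proof (cases "p dvd a")
    case True
    then have "p dvd a ^ p" using p by (simp add: dvd_power_same dvd_trans[OF _ dvd_power])
    with True show ?thesis by (simp add: cong_def mod_eq_0_iff_dvd)
  next
    case False
    then have "[a ^ (p - 1) * a = 1 * a] (mod p)"
      by (intro cong_mult fermat_theorem assms cong_refl)
    then show ?thesis using p by (simp flip: power_Suc2)
  qed
  then have "[int a ^ p = int a] (mod int p)"
    by (metis cong_int_iff of_nat_power)
  then show ?thesis
    by (meson a cong_pow cong_sym cong_trans)
qed

text \<open>With \<open>p = 3 * k + 2\<close> cubing is injective modulo \<open>p\<close>: the power
  \<open>2 * k + 1\<close> inverts it, as \<open>3 * (2 * k + 1) = 2 * p - 1\<close>. Now
  \<open>u ^ 3 + v ^ 3\<close> is a multiple of the form, so \<open>p\<close> divides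
  \<open>u + v\<close>; modulo \<open>u + v\<close> the form is
  \<open>3 * v\<^sup>2\<close>.\<close>

lemma prime_dvd_qform:
  assumes p: "prime p" "[p = 2] (mod 3)" and dvd: "int p dvd qform (u, v)"
  shows "int p dvd u" "int p dvd v"
proof -
  define k where "k = p div 3"
  have k: "p = 3 * k + 2" using p(2) unfolding k_def cong_def by presburger
  have pp: "prime (int p)" using p by simp
  have root: "[x ^ (3 * (2 * k + 1)) = x] (mod int p)" for x
  proof -
    have "[x ^ (p - 1) * x ^ p = x ^ (p - 1) * x] (mod int p)"
      by (intro cong_mult cong_refl fermat_int p)
    also have "x ^ (p - 1) * x = x ^ p" by (simp add: k)
    also have "[x ^ p = x] (mod int p)" by (rule fermat_int[OF p(1)])
    also have "x ^ (p - 1) * x ^ p = x ^ (3 * (2 * k + 1))"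
    proof -
      have "p - 1 + p = 3 * (2 * k + 1)" using k by simp
      then show ?thesis by (metis power_add)
    qed
    finally show ?thesis .
  qed
  have "int p dvd (u + v) * qform (u, v)" using dvd by simp
  also have "(u + v) * qform (u, v) = u ^ 3 - (- v) ^ 3"
    by (simp add: qform_def power2_eq_square power3_eq_cube algebra_simps)
  finally have "[u ^ 3 = (- v) ^ 3] (mod int p)" by (simp add: cong_iff_dvd_diff)
  then have "[(u ^ 3) ^ (2 * k + 1) = ((- v) ^ 3) ^ (2 * k + 1)] (mod int p)"
    by (rule cong_pow)
  then have "[u = - v] (mod int p)"
    unfolding power_mult[symmetric] using root by (meson cong_sym cong_trans)
  then have uv: "int p dvd u + v" by (simp add: cong_iff_dvd_diff)
  have "3 * v\<^sup>2 = qform (u, v) - (u + v) * (u - 2 * v)"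
    by (simp add: qform_def power2_eq_square algebra_simps)
  then have "int p dvd 3 * v\<^sup>2" using dvd uv by simp
  moreover have "\<not> int p dvd 3"
  proof
    assume "int p dvd 3"
    then have "p dvd 3" by (metis int_dvd_int_iff of_nat_numeral)
    then have "p \<le> 3" by (rule dvd_imp_le) simp
    then have "p = 2" using k by simp
    with \<open>p dvd 3\<close> show False by simp
  qed
  ultimately show v: "int p dvd v"
    using pp by (meson prime_dvd_mult_iff prime_dvd_power)
  then show "int p dvd u" using uv by (simp add: dvd_add_left_iff)
qed

lemma qform_scale: "qform (c * u, c * v) = c\<^sup>2 * qform (u, v)"
  by (simp add: qform_def power2_eq_square algebra_simps)

text \<open>Descent: \<open>p (Suc k)\<close> divides both \<open>u\<close> and \<open>v\<close>, so
  its square cancels and a smaller representation remains. At the end \<open>q\<close> divides both,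
  forcing \<open>q\<close> to divide \<open>t\<close>. One square is removed at a time, so repeated
  primes do no harm.\<close>

lemma qform_not_represented:
  fixes p :: "nat \<Rightarrow> nat"
  assumes "\<And>i. i \<in> {1..k} \<Longrightarrow> prime (p i) \<and> [p i = 2] (mod 3)"
    and q: "prime q" "[q = 2] (mod 3)" "\<not> int q dvd t"
  shows "qform (u, v) \<noteq> (\<Prod>i=1..k. (int (p i))\<^sup>2) * (int q * t)"
  using assms(1)
proof (induction k arbitrary: u v)
  case 0
  show ?case
  proof
    assume "qform (u, v) = (\<Prod>i=1..0. (int (p i))\<^sup>2) * (int q * t)"
    then have eq: "qform (u, v) = int q * t" by simp
    then obtain u' v' where "u = int q * u'" "v = int q * v'"
      using prime_dvd_qform[OF q(1,2), of u v] by (auto elim!: dvdE)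
    with eq have "int q * (int q * qform (u', v')) = int q * t"
      by (simp add: qform_scale power2_eq_square mult.assoc)
    then have "int q * qform (u', v') = t"
      using q(1) prime_gt_0_nat by simp
    with q(3) show False by auto
  qed
next
  case (Suc k)
  have p: "prime (p (Suc k))" "[p (Suc k) = 2] (mod 3)" using Suc.prems by auto
  show ?case
  proof
    assume eq: "qform (u, v) = (\<Prod>i=1..Suc k. (int (p i))\<^sup>2) * (int q * t)"
    then have "int (p (Suc k)) dvd qform (u, v)" by (simp add: power2_eq_square)
    then obtain u' v' where uv: "u = int (p (Suc k)) * u'" "v = int (p (Suc k)) * v'"
      using prime_dvd_qform[OF p, of u v] by (auto elim!: dvdE)
    have prod: "(\<Prod>i=1..Suc k. (int (p i))\<^sup>2) = (\<Prod>i=1..k. (int (p i))\<^sup>2) * (int (p (Suc k)))\<^sup>2"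
      by simp
    have "(int (p (Suc k)))\<^sup>2 * qform (u', v')
      = (int (p (Suc k)))\<^sup>2 * ((\<Prod>i=1..k. (int (p i))\<^sup>2) * (int q * t))"
      using eq unfolding uv qform_scale prod by (simp only: mult_ac)
    then have "qform (u', v') = (\<Prod>i=1..k. (int (p i))\<^sup>2) * (int q * t)"
      using prime_gt_0_nat[OF p(1)] by simp
    moreover have "qform (u', v') \<noteq> (\<Prod>i=1..k. (int (p i))\<^sup>2) * (int q * t)"
      by (rule Suc.IH) (use Suc.prems in auto)
    ultimately show False by simp
  qed
qed

theorem theorem1p8:
  fixes k n :: nat and p :: "nat \<Rightarrow> nat" and j :: int
  assumes "\<And>i. i \<in> {1..k+1} \<Longrightarrow> prime (p i)"
    and "\<And>i. i \<in> {1..k+1} \<Longrightarrow> [p i = 2] (mod 3)"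
    and "\<not> [j = 0] (mod int (p (k+1)))"
  shows "[B5 ((\<Prod>i=1..k. (int (p i))\<^sup>2) * (int (p (k+1)))\<^sup>2 * int n
              + ((\<Prod>i=1..k. (int (p i))\<^sup>2) * int (p (k+1)) * (3 * j + int (p (k+1))) - 1) div 3)
          = 0] (mod 5)"
proof -
  define P where "P = (\<Prod>i=1..k. (int (p i))\<^sup>2)"
  define q where "q = p (k+1)"
  define m where "m = P * (int q)\<^sup>2 * int n + (P * int q * (3 * j + int q) - 1) div 3"
  \<comment> \<open>The cofactor in \<open>3 * m + 1 = P * q * t\<close>. Modulo \<open>q\<close> it
    is \<open>3 * j\<close>, which is nonzero because \<open>q\<close> is not 3 and does not divide
    \<open>j\<close>.\<close>
  define t where "t = 3 * (int q * int n + j) + int q"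
  have q: "prime q" "[q = 2] (mod 3)" using assms by (auto simp: q_def)
  have m3: "3 * m + 1 = P * (int q * t)"
    using three_dvd_B5_argument[where p = p and k = k and j = j, OF assms(2)]
    by (auto simp: m_def t_def P_def q_def power2_eq_square algebra_simps elim!: dvdE)
  have "\<not> int q dvd t"
  proof
    assume "int q dvd t"
    then have "int q dvd 3 * (int q * int n + j)" by (simp add: t_def dvd_add_left_iff)
    moreover have "\<not> int q dvd 3"
    proof
      assume "int q dvd 3"
      then have "q dvd 3" by (metis int_dvd_int_iff of_nat_numeral)
      then have "q = 3" using q(1) by (simp add: primes_dvd_imp_eq)
      with q(2) show False by (simp add: cong_def)
    qed
    ultimately have "int q dvd int q * int n + j"
      using prime_dvd_multD[of "int q"] q(1) by (metis prime_nat_int_transfer)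
    then have "int q dvd j" by (simp add: dvd_add_right_iff)
    with assms(3) show False by (simp add: q_def cong_0_iff)
  qed
  then have rep: "qform (u, v) \<noteq> 3 * m + 1" for u v
    unfolding m3 P_def by (intro qform_not_represented q) (use assms in auto)
  have "[B5 m = 0] (mod 5)"
  \<comment> \<open>A sufficiently negative \<open>j\<close> makes the argument negative.\<close>
  proof (cases "m < 0")
    case True
    then show ?thesis by (simp add: B5_neg)
  next
    case False
    then obtain N where N: "m = int N" by (metis not_less zero_le_imp_eq_int)
    have "[int (B5 m) = int 0] (mod int 5)"
      using B5_cong_euler[of N] euler_pow8_eq_0[of N] rep by (simp add: N)
    then show ?thesis by (simp only: cong_int_iff)
  qed
  then show ?thesis by (simp add: m_def P_def q_def)
qed

end
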